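(* Let $T$ be a thick tree with loops with vertex set $V$ and sink $s\in V$, let $V_0=V\setminus\{s\}$, and let $\mathbf e^T\in\mathbb{Z}_{\ge0}^{V_0}$ be the identity element of its sandpile group (the identity configuration). Then $\mathbf e^T$ is given recursively, for $j\in V_0$, by $$e^T_j=\begin{cases}0, & \text{if } j\text{ is a leaf},\\ \lambda_j e_{j,p(j)}-\sum_{i\succ j}e^T_i, & \text{otherwise},\end{cases}$$ where $$\lambda_j=\left\lfloor\frac{\deg(j)+\sum_{i\succ j}e^T_i-1}{e_{j,p(j)}}\right\rfloor.$$
   Context: Graphs are finite, connected, undirected, with multiple edges and loops allowed. For vertices $i,j$, $e_{i,j}$ is the number of edges with endpoint set $\{i,j\}$ (so $e_{i,i}$ is the number of loops at $i$), and $\deg(i)=\sum_{j\in V}e_{i,j}$, so each loop is counted once. A distinguished vertex $s\in V$ is called the sink; $V_0=V\setminus\{s\}$. Thick tree with loops: a graph $T$ such that the simple graph $T'$ obtained by deleting all loops and reducing all nonzero edge multiplicities to $1$ is a tree. A leaf is a vertex $i\ne s$ of degree $1$ in $T'$. For $i,j\in V$, write $i\succeq j$ if $j$ lies on the unique path in $T'$ from $i$ to $s$ (endpoints included), and $i\succ j$ if moreover $i\ne j$. For $j\in V_0$, the parent $p(j)$ is the neighbour of $j$ in $T'$ lying on the path from $j$ to $s$ (i.e. $p(j)$ is adjacent to $j$ and $j\succ p(j)$). Sandpile model: a configuration is a vector $\mathbf u\in\mathbb{Z}_{\ge0}^{V_0}$. A vertex $i\in V_0$ is stable for $\mathbf u$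 if $u_i<\deg(i)$, otherwise unstable; $\mathbf u$ is stable if all vertices of $V_0$ are. Toppling an unstable vertex $i$ replaces $u_i$ by $u_i-\deg(i)+e_{i,i}$ and $u_j$ by $u_j+e_{i,j}$ for each $j\in V_0$, $j\ne i$. Repeatedly toppling unstable vertices leads, in finitely many steps, to a stable configuration that is independent of the choices, denoted $\sigma(\mathbf u)$ (the stabilization). Put $\mathbf u\oplus\mathbf v=\sigma(\mathbf u+\mathbf v)$. A configuration $\mathbf u$ is recurrent if for every configuration $\mathbf v$ there is a configuration $\mathbf w$ with $\mathbf v\oplus\mathbf w=\mathbf u$. The set $G$ of recurrent configurations is an abelian group under $\oplus$ (known), called the sandpile group.
   Formalization: The value 0 is asserted only at leaves without loops; a leaf carrying loops follows the "otherwise" formula, since 0 is false there: with one edge {j,s} and one loop at j, the identity has value 1 at j. *)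

theory Defs
  imports Complex_Main "HOL-Library.Multiset" "HOL-Algebra.Group"
begin

section \<open>Multigraphs and thick trees\<close>

text \<open>
  A finite undirected multigraph is given by its vertex set \<open>V\<close> and the multiset \<open>E\<close> of the
  endpoint sets of its edges; a loop at \<open>i\<close> contributes the singleton \<open>{i, i} = {i}\<close>.
\<close>

definition edge_mult :: "'a set multiset \<Rightarrow> 'a \<Rightarrow> 'a \<Rightarrow> nat" where
  "edge_mult E i j = count E {i, j}"

text \<open>Each loop is counted once.\<close>

definition deg :: "'a set \<Rightarrow> 'a set multiset \<Rightarrow> 'a \<Rightarrow> nat" where
  "deg V E i = (\<Sum>j\<in>V. edge_mult E i j)"

definition is_path :: "'a set multiset \<Rightarrow> 'a list \<Rightarrow> 'a \<Rightarrow> 'a \<Rightarrow> bool" where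
  "is_path E xs x y \<longleftrightarrow> xs \<noteq> [] \<and> hd xs = x \<and> last xs = y \<and> distinct xs \<and>
     successively (\<lambda>i j. {i, j} \<in># E) xs"

definition connected_graph :: "'a set \<Rightarrow> 'a set multiset \<Rightarrow> bool" where
  "connected_graph V E \<longleftrightarrow> (\<forall>x\<in>V. \<forall>y\<in>V. \<exists>xs. is_path E xs x y)"

definition multigraph :: "'a set \<Rightarrow> 'a set multiset \<Rightarrow> bool" where
  "multigraph V E \<longleftrightarrow> finite V \<and> V \<noteq> {} \<and> (\<forall>A\<in>#E. \<exists>i\<in>V. \<exists>j\<in>V. A = {i, j}) \<and>
     connected_graph V E"

text \<open>The list \<open>xs\<close> is read cyclically.\<close>

definition is_cycle :: "'a set multiset \<Rightarrow> 'a list \<Rightarrow> bool" where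
  "is_cycle E xs \<longleftrightarrow> length xs \<ge> 3 \<and> distinct xs \<and>
     successively (\<lambda>i j. {i, j} \<in># E) xs \<and> {last xs, hd xs} \<in># E"

text \<open>
  Only meant for simple graphs: \<^const>\<open>is_cycle\<close> does not see loops or pairs of parallel edges.
\<close>

definition is_tree :: "'a set \<Rightarrow> 'a set multiset \<Rightarrow> bool" where
  "is_tree V E \<longleftrightarrow> connected_graph V E \<and> (\<nexists>xs. is_cycle E xs)"

text \<open>Delete all loops and reduce all nonzero multiplicities to 1.\<close>

definition simple_graph :: "'a set multiset \<Rightarrow> 'a set multiset" where
  "simple_graph E = mset_set {A \<in> set_mset E. card A = 2}"

definition thick_tree :: "'a set \<Rightarrow> 'a set multiset \<Rightarrow> bool" where
  "thick_tree V E \<longleftrightarrow> multigraph V E \<and> is_tree V (simple_graph E)"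

definition leaf :: "'a set \<Rightarrow> 'a set multiset \<Rightarrow> 'a \<Rightarrow> 'a \<Rightarrow> bool" where
  "leaf V E s i \<longleftrightarrow> i \<in> V \<and> i \<noteq> s \<and> deg V (simple_graph E) i = 1"

text \<open>
  \<open>above_eq E s i j\<close> and \<open>above E s i j\<close> stand for $i \succeq j$ and $i \succ j$; the sink \<open>s\<close> is
  the least element.
\<close>

definition above_eq :: "'a set multiset \<Rightarrow> 'a \<Rightarrow> 'a \<Rightarrow> 'a \<Rightarrow> bool" where
  "above_eq E s i j \<longleftrightarrow> j \<in> set (THE xs. is_path (simple_graph E) xs i s)"

definition above :: "'a set multiset \<Rightarrow> 'a \<Rightarrow> 'a \<Rightarrow> 'a \<Rightarrow> bool" where
  "above E s i j \<longleftrightarrow> above_eq E s i j \<and> i \<noteq> j"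

definition parent :: "'a set multiset \<Rightarrow> 'a \<Rightarrow> 'a \<Rightarrow> 'a" where
  "parent E s j = (THE k. {j, k} \<in># simple_graph E \<and> above E s j k)"

section \<open>The sandpile model\<close>

text \<open>
  Vectors indexed by \<open>V - {s}\<close> are functions on the whole type that vanish outside \<open>V - {s}\<close>.
\<close>

definition configurations :: "'a set \<Rightarrow> 'a \<Rightarrow> ('a \<Rightarrow> nat) set" where
  "configurations V s = {u. \<forall>i. i \<notin> V - {s} \<longrightarrow> u i = 0}"

definition stable :: "'a set \<Rightarrow> 'a set multiset \<Rightarrow> 'a \<Rightarrow> ('a \<Rightarrow> nat) \<Rightarrow> bool" where
  "stable V E s u \<longleftrightarrow> (\<forall>i\<in>V - {s}. u i < deg V E i)"

text \<open>Only applied to \<open>i\<close> with \<open>deg V E i \<le> u i\<close>, so the subtraction does not truncate.\<close>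

definition topple ::
  "'a set \<Rightarrow> 'a set multiset \<Rightarrow> 'a \<Rightarrow> 'a \<Rightarrow> ('a \<Rightarrow> nat) \<Rightarrow> ('a \<Rightarrow> nat)" where
  "topple V E s i u =
     (\<lambda>j. if j \<notin> V - {s} then 0
          else if j = i then u i - deg V E i + edge_mult E i i
          else u j + edge_mult E i j)"

definition topple_step ::
  "'a set \<Rightarrow> 'a set multiset \<Rightarrow> 'a \<Rightarrow> ('a \<Rightarrow> nat) \<Rightarrow> ('a \<Rightarrow> nat) \<Rightarrow> bool" where
  "topple_step V E s u w \<longleftrightarrow> (\<exists>i\<in>V - {s}. deg V E i \<le> u i \<and> w = topple V E s i u)"

definition stabilization ::
  "'a set \<Rightarrow> 'a set multiset \<Rightarrow> 'a \<Rightarrow> ('a \<Rightarrow> nat) \<Rightarrow> ('a \<Rightarrow> nat)" where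
  "stabilization V E s u = (THE w. (topple_step V E s)\<^sup>*\<^sup>* u w \<and> stable V E s w)"

definition sandpile_add ::
  "'a set \<Rightarrow> 'a set multiset \<Rightarrow> 'a \<Rightarrow> ('a \<Rightarrow> nat) \<Rightarrow> ('a \<Rightarrow> nat) \<Rightarrow> ('a \<Rightarrow> nat)" where
  "sandpile_add V E s u v = stabilization V E s (\<lambda>i. u i + v i)"

definition recurrent :: "'a set \<Rightarrow> 'a set multiset \<Rightarrow> 'a \<Rightarrow> ('a \<Rightarrow> nat) \<Rightarrow> bool" where
  "recurrent V E s u \<longleftrightarrow> u \<in> configurations V s \<and>
     (\<forall>v\<in>configurations V s. \<exists>w\<in>configurations V s. sandpile_add V E s v w = u)"

definition sandpile_group ::
  "'a set \<Rightarrow> 'a set multiset \<Rightarrow> 'a \<Rightarrow> ('a \<Rightarrow> nat) monoid" where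
  "sandpile_group V E s =
     \<lparr>carrier = {u. recurrent V E s u},
      monoid.mult = sandpile_add V E s,
      one = (THE e. recurrent V E s e \<and>
               (\<forall>u. recurrent V E s u \<longrightarrow>
                  sandpile_add V E s e u = u \<and> sandpile_add V E s u e = u))\<rparr>"

text \<open>
  The value of the identity configuration at \<open>j\<close> in terms of its values \<open>x i\<close> at the vertices
  $i \succ j$.

  The value 0 is prescribed only at leaves without loops; a leaf carrying loops falls under the
  general formula. At such leaves the value 0 can be wrong: for \<open>V = {j, s}\<close> with one edge
  \<open>{j, s}\<close> and one loop at \<open>j\<close>, toppling \<open>j\<close> requires at least 2 grains and removes 1, so the
  only recurrent configuration, hence the identity, has value 1 at \<open>j\<close>.
\<close>

definition above_sum :: "'a set \<Rightarrow> 'a set multiset \<Rightarrow> 'a \<Rightarrow> ('a \<Rightarrow> nat) \<Rightarrow> 'a \<Rightarrow> nat" where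
  "above_sum V E s x j = (\<Sum>i\<in>{i \<in> V. above E s i j}. x i)"

definition lam :: "'a set \<Rightarrow> 'a set multiset \<Rightarrow> 'a \<Rightarrow> ('a \<Rightarrow> nat) \<Rightarrow> 'a \<Rightarrow> int" where
  "lam V E s x j =
     \<lfloor>(real (deg V E j) + real (above_sum V E s x j) - 1) / real (edge_mult E j (parent E s j))\<rfloor>"

end

theory Submission
  imports Defs
begin

text \<open>
  Writing \<open>F j\<close> for the set of vertices $i \succeq j$, a stable configuration is recurrent only if
  $\deg(j) - e_{j,p(j)} \le u_j < \deg(j)$ for all \<open>j\<close>, because the only edges that leave \<open>F j\<close>
  join \<open>j\<close> to its parent.  For the same reason toppling preserves the sum of \<open>u\<close> over \<open>F j\<close>
  modulo $e_{j,p(j)}$.  A recurrent configuration is therefore determined by these residues, which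
  all vanish for the identity; solving for its value at \<open>j\<close> in an interval of length $e_{j,p(j)}$
  gives the formula.  At a leaf without loops $\deg(j) = e_{j,p(j)}$, which leaves only the value 0.
\<close>

section \<open>Unique paths in an acyclic graph\<close>

lemma is_path_Cons_Cons:
  "is_path G (x # y # ys) a z \<longleftrightarrow>
     a = x \<and> {x, y} \<in># G \<and> x \<notin> set (y # ys) \<and> is_path G (y # ys) y z"
  by (auto simp: is_path_def)

lemma is_path_Cons:
  assumes "is_path G ys y z" "{x, y} \<in># G" "x \<notin> set ys"
  shows "is_path G (x # ys) x z"
  using assms by (cases ys) (auto simp: is_path_def)

lemma is_path_suffix:
  assumes "is_path G (xs @ y # ys) x z"
  shows "is_path G (y # ys) y z"
  using assms by (auto simp: is_path_def successively_append_iff)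

text \<open>The chord from \<open>x\<close> to \<open>y\<close> closes the initial segment of the
  path; \<open>xs\<close> being nonempty supplies the third vertex that \<open>is_cycle\<close>
  demands.\<close>

lemma is_path_prefix_cycle:
  assumes "is_path G (x # xs @ y # ys) x z" "{x, y} \<in># G" "xs \<noteq> []"
  shows "is_cycle G (x # xs @ [y])"
proof -
  have "is_path G ((x # xs @ [y]) @ ys) x z"
    using assms(1) by simp
  then have "distinct (x # xs @ [y])" "successively (\<lambda>i j. {i, j} \<in># G) (x # xs @ [y])"
    unfolding is_path_def successively_append_iff by auto
  moreover have "length (x # xs @ [y]) \<ge> 3"
    using assms(3) by (cases xs) auto
  ultimately show ?thesis
    using assms(2) by (auto simp: is_cycle_def insert_commute)
qed

text \<open>The second vertex \<open>k\<close> of \<open>p\<close> lies on \<open>q\<close>: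
  otherwise \<open>k # q\<close> would be another path from \<open>k\<close> to \<open>z\<close>,
  equal by induction to the tail of \<open>p\<close>, which avoids \<open>x\<close>. The tail of
  \<open>p\<close> then equals the part of \<open>q\<close> from \<open>k\<close> on, and any vertex
  of \<open>q\<close> between \<open>x\<close> and \<open>k\<close> would produce a cycle.\<close>

lemma acyclic_path_unique:
  assumes acyclic: "\<nexists>xs. is_cycle G xs"
    and "is_path G p x z" "is_path G q x z"
  shows "p = q"
  using assms(2,3)
proof (induction p arbitrary: x q)
  case Nil
  then show ?case by (simp add: is_path_def)
next
  case (Cons a p')
  obtain q' where q: "q = x # q'"
    using Cons.prems(2) by (cases q) (auto simp: is_path_def)
  have a: "a = x"
    using Cons.prems(1) by (auto simp: is_path_def)
  show ?case
  proof (cases p')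
    case Nil
    then have "x = z" using Cons.prems(1) by (auto simp: is_path_def)
    then have "q' = []"
      using Cons.prems(2) q by (auto simp: is_path_def split: if_splits)
    then show ?thesis using a q Nil by simp
  next
    case p': (Cons k p'')
    have edge: "{x, k} \<in># G" and path: "is_path G p' k z" and notin: "x \<notin> set p'"
      using Cons.prems(1) p' a by (auto simp: is_path_Cons_Cons)
    have "k \<in> set q"
    proof (rule ccontr)
      assume "k \<notin> set q"
      then have "is_path G (k # q) k z"
        using is_path_Cons[OF Cons.prems(2)] edge by (simp add: insert_commute)
      then have "p' = k # q" using Cons.IH path by blast
      then show False using notin q by simp
    qed
    moreover have "k \<noteq> x" using notin p' by auto
    ultimately obtain xs ys where q'_eq: "q' = xs @ k # ys"
      using q by (auto dest: split_list)
    have "is_path G ((x # xs) @ k # ys) x z"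
      using Cons.prems(2) q q'_eq by simp
    from Cons.IH[OF path is_path_suffix[OF this]] have "p' = k # ys" .
    moreover have "xs = []"
      using acyclic is_path_prefix_cycle[of G x xs k ys z] Cons.prems(2) q q'_eq edge by auto
    ultimately show ?thesis using a q q'_eq by simp
  qed
qed

section \<open>Toppling\<close>

lemma edge_mult_commute: "edge_mult E i j = edge_mult E j i"
  by (simp add: edge_mult_def insert_commute)

lemma topple_commute:
  assumes "i \<noteq> j" "i \<in> V - {s}" "j \<in> V - {s}" "deg V E i \<le> u i" "deg V E j \<le> u j"
  shows "topple V E s j (topple V E s i u) = topple V E s i (topple V E s j u)"
  using assms by (auto simp: topple_def fun_eq_iff)

text \<open>Toppling one vertex never takes grains from another, so two different unstable vertices
  can be toppled in either order, with the same result.\<close>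

lemma topple_step_diamond:
  assumes "topple_step V E s u a" "topple_step V E s u b" "a \<noteq> b"
  shows "\<exists>c. topple_step V E s a c \<and> topple_step V E s b c"
proof -
  obtain i j where i: "i \<in> V - {s}" "deg V E i \<le> u i" "a = topple V E s i u"
    and j: "j \<in> V - {s}" "deg V E j \<le> u j" "b = topple V E s j u"
    using assms(1,2) by (auto simp: topple_step_def)
  have ij: "i \<noteq> j" using assms(3) i j by auto
  then have "deg V E j \<le> a j" "deg V E i \<le> b i"
    using i j by (auto simp: topple_def)
  then have "topple_step V E s a (topple V E s j a)" "topple_step V E s b (topple V E s i b)"
    using i j by (auto simp: topple_step_def)
  moreover have "topple V E s j a = topple V E s i b"
    using topple_commute[OF ij] i j by simp
  ultimately show ?thesis by metis
qed

lemma stable_iff_no_step: "stable V E s u \<longleftrightarrow> (\<nexists>w. topple_step V E s u w)"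
  unfolding stable_def topple_step_def by (metis not_less)

text \<open>A first step chosen differently does no harm: the diamond is pushed along the given
  sequence until the stable end, where no step is left.\<close>

lemma topple_steps_step:
  assumes "(topple_step V E s)\<^sup>*\<^sup>* u a" "stable V E s a" "topple_step V E s u v"
  shows "(topple_step V E s)\<^sup>*\<^sup>* v a"
  using assms(1,3)
proof (induction arbitrary: v rule: converse_rtranclp_induct)
  case base
  then show ?case using assms(2) stable_iff_no_step by metis
next
  case (step u u')
  show ?case
  proof (cases "u' = v")
    case True
    then show ?thesis using step by simp
  next
    case False
    then obtain c where "topple_step V E s u' c" "topple_step V E s v c"
      using topple_step_diamond step by metis
    then show ?thesis
      using step.IH by (meson converse_rtranclp_into_rtranclp)
  qed
qed

lemma stable_reachable_unique:
  assumes "(topple_step V E s)\<^sup>*\<^sup>* u a" "stable V E s a"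
    and "(topple_step V E s)\<^sup>*\<^sup>* u b" "stable V E s b"
  shows "a = b"
  using assms(1,3)
proof (induction rule: converse_rtranclp_induct)
  case base
  then show ?case
    using assms(2) stable_iff_no_step by (metis converse_rtranclpE)
next
  case (step u u')
  then show ?case
    using topple_steps_step assms(4) by metis
qed

lemma stabilization_eqI:
  assumes "(topple_step V E s)\<^sup>*\<^sup>* u w" "stable V E s w"
  shows "stabilization V E s u = w"
  unfolding stabilization_def using assms stable_reachable_unique[of V E s u]
  by (intro the_equality) auto

lemma topple_steps_configurations:
  assumes "(topple_step V E s)\<^sup>*\<^sup>* u w" "u \<in> configurations V s"
  shows "w \<in> configurations V s"
  using assms by (induction) (auto simp: topple_step_def topple_def configurations_def)

lemma topple_step_add:
  assumes "topple_step V E s u w" "v \<in> configurations V s"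
  shows "topple_step V E s (\<lambda>i. u i + v i) (\<lambda>i. w i + v i)"
proof -
  obtain i where "i \<in> V - {s}" "deg V E i \<le> u i" "w = topple V E s i u"
    using assms(1) by (auto simp: topple_step_def)
  then show ?thesis
    using assms(2) unfolding topple_step_def
    by (intro bexI[of _ i]) (auto simp: topple_def configurations_def fun_eq_iff)
qed

lemma topple_steps_add:
  assumes "(topple_step V E s)\<^sup>*\<^sup>* u w" "v \<in> configurations V s"
  shows "(topple_step V E s)\<^sup>*\<^sup>* (\<lambda>i. u i + v i) (\<lambda>i. w i + v i)"
  using assms(1)
  by (induction) (auto intro: rtranclp.rtrancl_into_rtrancl topple_step_add[OF _ assms(2)])

lemma sandpile_add_commute: "sandpile_add V E s u v = sandpile_add V E s v u"
  by (simp add: sandpile_add_def add.commute)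

lemma configurations_add:
  "u \<in> configurations V s \<Longrightarrow> v \<in> configurations V s \<Longrightarrow> (\<lambda>i. u i + v i) \<in> configurations V s"
  by (simp add: configurations_def)

text \<open>In Dhar's terminology: no \<open>F\<close> ever becomes a forbidden subconfiguration.\<close>

lemma topple_steps_no_forbidden:
  assumes "(topple_step V E s)\<^sup>*\<^sup>* u w" "finite V"
    and "\<And>i. i \<in> V - {s} \<Longrightarrow> deg V E i \<le> u i"
    and "F \<noteq> {}" "F \<subseteq> V - {s}"
  shows "\<exists>i\<in>F. (\<Sum>k\<in>F. edge_mult E i k) \<le> w i"
  using assms(1,4,5)
proof (induction arbitrary: F rule: rtranclp_induct)
  case base
  then obtain i where i: "i \<in> F" by auto
  have "(\<Sum>k\<in>F. edge_mult E i k) \<le> deg V E i"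
    unfolding deg_def using base assms(2) by (intro sum_mono2) auto
  also have "\<dots> \<le> u i" using assms(3) i base by auto
  finally show ?case using i by auto
next
  case (step v w)
  have fin: "finite F" using step.prems assms(2) finite_subset by blast
  obtain k where k: "k \<in> V - {s}" "deg V E k \<le> v k" "w = topple V E s k v"
    using step.hyps(2) by (auto simp: topple_step_def)
  show ?case
  proof (cases "F - {k} = {}")
    case True
    \<comment> \<open>A vertex that has just toppled still holds at least one grain for each of its
      loops.\<close>
    then have "F = {k}" using step.prems by auto
    then show ?thesis using k by (auto simp: topple_def)
  next
    case False
    \<comment> \<open>Toppling \<open>k\<close> gives \<open>i\<close> exactly the
      \<open>edge_mult E i k\<close> grains by which its requirement may grow when \<open>k\<close>
      is put back into the set.\<close>
    then obtain i where i: "i \<in> F - {k}" "(\<Sum>l\<in>F - {k}. edge_mult E i l) \<le> v i"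
      using step.IH[of "F - {k}"] step.prems by auto
    have "(\<Sum>l\<in>F. edge_mult E i l) \<le> (\<Sum>l\<in>F - {k}. edge_mult E i l) + edge_mult E i k"
      using fin by (cases "k \<in> F") (auto simp: sum.remove[of F k])
    also have "\<dots> \<le> v i + edge_mult E i k" using i by simp
    also have "\<dots> = w i"
      using i k step.prems by (auto simp: topple_def edge_mult_commute)
    finally show ?thesis using i by auto
  qed
qed

lemma sum_topple:
  assumes "finite F" "F \<subseteq> V - {s}" "deg V E i \<le> u i"
  shows "int (sum (topple V E s i u) F) =
    int (sum u F) + int (\<Sum>k\<in>F. edge_mult E i k) - (if i \<in> F then int (deg V E i) else 0)"
proof -
  have "int (topple V E s i u k) =
      int (u k) + int (edge_mult E i k) - (if k = i then int (deg V E i) else 0)" if "k \<in> F" for k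
    using that assms by (auto simp: topple_def)
  then have "(\<Sum>k\<in>F. int (topple V E s i u k)) =
      (\<Sum>k\<in>F. int (u k) + int (edge_mult E i k) - (if k = i then int (deg V E i) else 0))"
    by (rule sum.cong[OF refl])
  then show ?thesis
    using assms(1) by (simp add: sum_subtractf sum.distrib sum.delta)
qed

section \<open>Rooted thick trees\<close>

locale rooted_thick_tree =
  fixes V :: "'a set" and E :: "'a set multiset" and s :: 'a
  assumes thick_tree: "thick_tree V E" and sink: "s \<in> V"
begin

abbreviation "G \<equiv> simple_graph E"
abbreviation "par \<equiv> parent E s"

definition path_to_sink :: "'a \<Rightarrow> 'a list" where
  "path_to_sink i = (THE xs. is_path G xs i s)"

definition subtree :: "'a \<Rightarrow> 'a set" where
  "subtree j = {i \<in> V. above_eq E s i j}"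

lemma finite_V: "finite V"
  using thick_tree by (simp add: thick_tree_def multigraph_def)

lemma mem_simple_graph_iff: "{i, j} \<in># G \<longleftrightarrow> {i, j} \<in># E \<and> i \<noteq> j"
  by (cases "i = j") (auto simp: simple_graph_def)

lemma edge_mult_pos_iff: "i \<noteq> j \<Longrightarrow> 0 < edge_mult E i j \<longleftrightarrow> {i, j} \<in># G"
  by (auto simp: edge_mult_def mem_simple_graph_iff)

lemma edge_in_V:
  assumes "{i, j} \<in># G" shows "i \<in> V" "j \<in> V"
proof -
  have "{i, j} \<in># E" using assms mem_simple_graph_iff by auto
  then obtain a b where "a \<in> V" "b \<in> V" "{i, j} = {a, b}"
    using thick_tree unfolding thick_tree_def multigraph_def by blast
  then show "i \<in> V" "j \<in> V" by (auto simp: doubleton_eq_iff)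
qed

lemma acyclic: "\<nexists>xs. is_cycle G xs"
  using thick_tree by (simp add: thick_tree_def is_tree_def)

lemma path_to_sink_eqI: "is_path G xs i s \<Longrightarrow> path_to_sink i = xs"
  unfolding path_to_sink_def using acyclic_path_unique[OF acyclic] by blast

lemma is_path_path_to_sink: "i \<in> V \<Longrightarrow> is_path G (path_to_sink i) i s"
  using thick_tree sink path_to_sink_eqI
  unfolding thick_tree_def is_tree_def connected_graph_def by metis

lemma mem_subtree_iff: "i \<in> subtree j \<longleftrightarrow> i \<in> V \<and> j \<in> set (path_to_sink i)"
  by (simp add: subtree_def above_eq_def path_to_sink_def)

lemma finite_subtree: "finite (subtree j)"
  using finite_V by (simp add: subtree_def)

lemma subtree_refl: "j \<in> V \<Longrightarrow> j \<in> subtree j"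
  using is_path_path_to_sink[of j] hd_in_set[of "path_to_sink j"]
  by (auto simp: mem_subtree_iff is_path_def)

lemma path_to_sink_sink: "path_to_sink s = [s]"
  by (rule path_to_sink_eqI) (simp add: is_path_def)

lemma subtree_subset: "j \<noteq> s \<Longrightarrow> subtree j \<subseteq> V - {s}"
  by (auto simp: mem_subtree_iff path_to_sink_sink)

lemma distinct_path_to_sink: "i \<in> V \<Longrightarrow> distinct (path_to_sink i)"
  using is_path_path_to_sink by (auto simp: is_path_def)

text \<open>If \<open>i\<close> is not on the path of \<open>k\<close>, it can be prepended to it.
  If it is, it must be the second vertex, since otherwise the edge is a chord closing a
  cycle.\<close>

lemma path_to_sink_adjacent:
  assumes "{i, k} \<in># G"
  shows "path_to_sink i = i # path_to_sink k \<or> path_to_sink k = k # path_to_sink i"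
proof -
  have ne: "i \<noteq> k" using assms mem_simple_graph_iff by auto
  have k: "is_path G (path_to_sink k) k s"
    using edge_in_V assms is_path_path_to_sink by auto
  show ?thesis
  proof (cases "i \<in> set (path_to_sink k)")
    case False
    then show ?thesis using path_to_sink_eqI is_path_Cons[OF k assms] by auto
  next
    case True
    then obtain xs ys where split: "path_to_sink k = xs @ i # ys"
      by (auto dest: split_list)
    obtain zs where xs: "xs = k # zs"
      using k ne split by (cases xs) (auto simp: is_path_def)
    have "path_to_sink i = i # ys"
      using path_to_sink_eqI is_path_suffix k split by metis
    moreover have "zs = []"
      using acyclic is_path_prefix_cycle[of G k zs i ys s] k split xs assms
      by (auto simp: insert_commute)
    ultimately show ?thesis using split xs by simp
  qed
qed

text \<open>The other orientation would repeat \<open>k\<close> on its own path. This is what makes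
  the description in \<open>parent\<close> unique.\<close>

lemma parent_unique:
  assumes "{j, k} \<in># G" "k \<in> set (path_to_sink j)"
  shows "path_to_sink j = j # path_to_sink k"
  using path_to_sink_adjacent[OF assms(1)] assms distinct_path_to_sink[of k] edge_in_V[OF assms(1)]
  by auto

lemma parent_edge_path:
  assumes "j \<in> V - {s}"
  shows "{j, par j} \<in># G" "path_to_sink j = j # path_to_sink (par j)"
proof -
  have path: "is_path G (path_to_sink j) j s"
    using assms is_path_path_to_sink by auto
  then obtain k ks where ks: "path_to_sink j = j # k # ks"
    using assms by (cases "path_to_sink j" rule: list.exhaust; cases "tl (path_to_sink j)")
      (auto simp: is_path_def)
  then have edge: "{j, k} \<in># G" "j \<noteq> k"
    using path by (auto simp: is_path_def)
  have "par j = k"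
    unfolding parent_def
  proof (rule the_equality)
    show "{j, k} \<in># G \<and> above E s j k"
      using edge ks by (auto simp: above_def above_eq_def path_to_sink_def)
    fix k' assume "{j, k'} \<in># G \<and> above E s j k'"
    then have k': "{j, k'} \<in># G" "k' \<in> set (path_to_sink j)"
      by (auto simp: above_def above_eq_def path_to_sink_def)
    then have "path_to_sink k' = k # ks"
      using parent_unique[OF k'] ks by simp
    then show "k' = k"
      using is_path_path_to_sink[of k'] edge_in_V[OF k'(1)] by (auto simp: is_path_def)
  qed
  then show "{j, par j} \<in># G" "path_to_sink j = j # path_to_sink (par j)"
    using edge parent_unique[of j k] ks by auto
qed

lemma parent_notin_subtree:
  assumes "j \<in> V - {s}"
  shows "par j \<notin> subtree j"
  using parent_edge_path[OF assms] distinct_path_to_sink[of j] assms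
  by (auto simp: mem_subtree_iff)

lemma edge_mult_parent_pos:
  assumes "j \<in> V - {s}" shows "0 < edge_mult E j (par j)"
  using parent_edge_path[OF assms] edge_mult_pos_iff mem_simple_graph_iff by metis

text \<open>Paths of adjacent vertices differ by one vertex at the front. If \<open>j\<close> is on
  the path of \<open>i\<close> but not on that of \<open>k\<close>, the vertex lost is
  \<open>i\<close> itself, so \<open>i = j\<close> and \<open>k\<close> is the next vertex on its
  path.\<close>

lemma subtree_boundary:
  assumes j: "j \<in> V - {s}" and i: "i \<in> subtree j" and k: "k \<notin> subtree j"
    and e: "0 < edge_mult E i k"
  shows "i = j \<and> k = par j"
proof -
  have edge: "{i, k} \<in># G" using edge_mult_pos_iff i k e by metis
  have kV: "k \<in> V" using edge_in_V edge by auto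
  have k': "j \<notin> set (path_to_sink k)" using k kV mem_subtree_iff by auto
  have i': "j \<in> set (path_to_sink i)" using i mem_subtree_iff by auto
  from path_to_sink_adjacent[OF edge] k' i'
  have path: "path_to_sink i = i # path_to_sink k" by auto
  then have ij: "i = j" using i' k' by auto
  then have "path_to_sink k = path_to_sink (par j)"
    using path parent_edge_path(2)[OF j] by simp
  then have "k = par j"
    using is_path_path_to_sink kV edge_in_V(2)[OF parent_edge_path(1)[OF j]]
    unfolding is_path_def by metis
  then show ?thesis using ij by simp
qed

section \<open>Edge counts of subtrees and the residues preserved by toppling\<close>

lemma sum_edges_subtree_inner:
  assumes "j \<in> V - {s}" "i \<in> subtree j" "i \<noteq> j"
  shows "(\<Sum>k\<in>subtree j. edge_mult E i k) = deg V E i"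
  unfolding deg_def using finite_V subtree_boundary assms
  by (intro sum.mono_neutral_left) (auto simp: subtree_def)

lemma sum_edges_subtree_root:
  assumes "j \<in> V - {s}"
  shows "(\<Sum>k\<in>subtree j. edge_mult E j k) + edge_mult E j (par j) = deg V E j"
proof -
  have "(\<Sum>k\<in>insert (par j) (subtree j). edge_mult E j k) = deg V E j"
    unfolding deg_def
    using finite_V subtree_boundary[OF assms subtree_refl] assms
      edge_in_V(2)[OF parent_edge_path(1)[OF assms]]
    by (intro sum.mono_neutral_left) (auto simp: subtree_def)
  then show ?thesis
    using parent_notin_subtree[OF assms] finite_subtree by (simp add: add.commute)
qed

lemma sum_edges_subtree_outside:
  assumes "j \<in> V - {s}" "i \<notin> subtree j"
  shows "(\<Sum>k\<in>subtree j. edge_mult E i k) = (if i = par j then edge_mult E j (par j) else 0)"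
proof -
  have j: "j \<in> subtree j" using assms subtree_refl by auto
  have zero: "edge_mult E i k = 0" if "k \<in> subtree j" "k \<noteq> j \<or> i \<noteq> par j" for k
    using subtree_boundary[OF assms(1) that(1) assms(2)] that(2) edge_mult_commute
    by (metis gr0I)
  have "(\<Sum>k\<in>subtree j. edge_mult E i k) = edge_mult E i j"
    using zero finite_subtree j by (subst sum.remove[of _ j]) auto
  also have "\<dots> = (if i = par j then edge_mult E j (par j) else 0)"
    using zero[OF j] by (auto simp: edge_mult_commute)
  finally show ?thesis .
qed

text \<open>Toppling inside the subtree but not at \<open>j\<close> moves grains only within it;
  toppling \<open>j\<close> loses one grain per edge to the parent; toppling outside adds that same
  number if the parent topples and nothing otherwise.\<close>

lemma topple_step_subtree_sum_mod:
  assumes j: "j \<in> V - {s}" and "topple_step V E s u w"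
  shows "int (sum w (subtree j)) mod int (edge_mult E j (par j)) =
    int (sum u (subtree j)) mod int (edge_mult E j (par j))"
proof -
  obtain i where i: "i \<in> V - {s}" "deg V E i \<le> u i" "w = topple V E s i u"
    using assms(2) by (auto simp: topple_step_def)
  have sum: "int (sum w (subtree j)) = int (sum u (subtree j)) +
      int (\<Sum>k\<in>subtree j. edge_mult E i k) - (if i \<in> subtree j then int (deg V E i) else 0)"
    unfolding i(3) using finite_subtree subtree_subset j i(2) by (intro sum_topple) auto
  consider (inner) "i \<in> subtree j" "i \<noteq> j" | (root) "i = j" | (outside) "i \<notin> subtree j"
    by blast
  then show ?thesis
  proof cases
    case inner
    then show ?thesis using sum sum_edges_subtree_inner[OF j] by simp
  next
    case root
    then have "int (sum w (subtree j)) = int (sum u (subtree j)) - int (edge_mult E j (par j))"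
      using sum sum_edges_subtree_root[OF j] subtree_refl j by (simp flip: of_nat_sum)
    then show ?thesis by simp
  next
    case outside
    then show ?thesis using sum sum_edges_subtree_outside[OF j outside] by simp
  qed
qed

lemma topple_steps_subtree_sum_mod:
  assumes "(topple_step V E s)\<^sup>*\<^sup>* u w" "j \<in> V - {s}"
  shows "int (sum w (subtree j)) mod int (edge_mult E j (par j)) =
    int (sum u (subtree j)) mod int (edge_mult E j (par j))"
  using assms(1)
proof (induction)
  case (step v w)
  then show ?case using topple_step_subtree_sum_mod[OF assms(2)] by metis
qed simp

section \<open>Stabilization\<close>

definition depth :: "'a \<Rightarrow> nat" where
  "depth i = length (path_to_sink i) - 1"

text \<open>
  Going away from the sink, the increments of the weight decrease so quickly that one grain moved
  towards the sink outweighs \<^term>\<open>deg V E i\<close> grains moved away from it.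
\<close>

definition weight :: "'a \<Rightarrow> nat" where
  "weight i = (\<Sum>t<depth i. (Suc (\<Sum>k\<in>V. deg V E k)) ^ ((\<Sum>k\<in>V. depth k) - t))"

lemma length_path_to_sink: "i \<in> V \<Longrightarrow> length (path_to_sink i) = Suc (depth i)"
  using is_path_path_to_sink[of i] by (cases "path_to_sink i") (auto simp: depth_def is_path_def)

text \<open>With \<open>par i\<close> at depth \<open>n\<close>, \<open>e\<close> grains gain
  \<open>M ^ (D - n)\<close> by moving to the parent, while the other \<open>r < M\<close> each lose
  at most \<open>M ^ (D - Suc n)\<close>, a factor \<open>M\<close> less. This makes the total
  weight a termination measure for toppling.\<close>

lemma weight_superharmonic:
  assumes i: "i \<in> V - {s}"
  shows "(\<Sum>k\<in>V. edge_mult E i k * weight k) < deg V E i * weight i"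
proof -
  define M where "M = Suc (\<Sum>k\<in>V. deg V E k)"
  define D where "D = (\<Sum>k\<in>V. depth k)"
  define h where "h d = (\<Sum>t<d. M ^ (D - t))" for d
  have weight: "weight k = h (depth k)" for k
    by (simp add: weight_def h_def M_def D_def)
  have h_mono: "h a \<le> h b" if "a \<le> b" for a b
    unfolding h_def using that by (intro sum_mono2) auto
  have p: "par i \<in> V" "{i, par i} \<in># G" "path_to_sink i = i # path_to_sink (par i)"
    using parent_edge_path[OF i] edge_in_V by auto
  define n where "n = depth (par i)"
  have depth_i: "depth i = Suc n"
    using length_path_to_sink[of i] length_path_to_sink[OF p(1)] p(3) i by (simp add: n_def)
  have le: "edge_mult E i k * weight k \<le> edge_mult E i k * h (Suc (Suc n))" if "k \<in> V" for k
  proof (cases "k = i \<or> edge_mult E i k = 0")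
    case True
    then show ?thesis using depth_i h_mono by (auto simp: weight)
  next
    case False
    then have "{i, k} \<in># G" using edge_mult_pos_iff by auto
    from path_to_sink_adjacent[OF this] have "depth k \<le> Suc (depth i)"
      using length_path_to_sink[of i] length_path_to_sink[OF that] i by auto
    then show ?thesis using h_mono depth_i by (simp add: weight)
  qed
  define e where "e = edge_mult E i (par i)"
  define r where "r = (\<Sum>k\<in>V - {par i}. edge_mult E i k)"
  have deg: "deg V E i = e + r"
    unfolding deg_def e_def r_def using p finite_V by (simp add: sum.remove)
  have "deg V E i \<le> (\<Sum>k\<in>V. deg V E k)"
    using i finite_V by (intro member_le_sum) auto
  then have r: "r < M" using deg by (simp add: M_def)
  have e: "0 < e" using edge_mult_parent_pos[OF i] by (simp add: e_def)
  have "depth i \<le> D"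
    unfolding D_def using i finite_V by (intro member_le_sum) auto
  \<comment> \<open>The bound \<open>D\<close> on the depth keeps the exponents from truncating, so
    consecutive increments really differ by the factor \<open>M\<close>.\<close>
  then have D: "D - n = Suc (D - Suc n)" using depth_i by simp
  have "(\<Sum>k\<in>V. edge_mult E i k * weight k) \<le>
      e * h n + (\<Sum>k\<in>V - {par i}. edge_mult E i k * h (Suc (Suc n)))"
    using p finite_V le by (subst sum.remove[of _ "par i"]) (auto simp: e_def weight n_def intro: sum_mono)
  also have "\<dots> = e * h n + r * h (Suc (Suc n))"
    by (simp add: r_def sum_distrib_right)
  also have "\<dots> = e * h n + r * h (Suc n) + r * M ^ (D - Suc n)"
    by (simp add: h_def algebra_simps)
  also have "r * M ^ (D - Suc n) < M * M ^ (D - Suc n)"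
    using r by (intro mult_strict_right_mono) (auto simp: M_def)
  also have "M * M ^ (D - Suc n) \<le> e * M ^ (D - n)"
    using e D by simp
  also have "e * h n + r * h (Suc n) + e * M ^ (D - n) = deg V E i * weight i"
    by (simp add: deg weight depth_i h_def algebra_simps)
  finally show ?thesis by simp
qed

lemma topple_step_weight_less:
  assumes "topple_step V E s u w"
  shows "(\<Sum>k\<in>V - {s}. w k * weight k) < (\<Sum>k\<in>V - {s}. u k * weight k)"
proof -
  obtain i where i: "i \<in> V - {s}" "deg V E i \<le> u i" "w = topple V E s i u"
    using assms by (auto simp: topple_step_def)
  have fin: "finite (V - {s})" using finite_V by auto
  \<comment> \<open>The lost grains stand on the left so that no truncating subtraction
    occurs.\<close>
  have "w k * weight k + (if k = i then deg V E i * weight i else 0) =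
      u k * weight k + edge_mult E i k * weight k" if "k \<in> V - {s}" for k
    using that i by (auto simp: topple_def simp flip: add_mult_distrib)
  then have "(\<Sum>k\<in>V - {s}. w k * weight k + (if k = i then deg V E i * weight i else 0)) =
      (\<Sum>k\<in>V - {s}. u k * weight k + edge_mult E i k * weight k)"
    by (rule sum.cong[OF refl])
  then have "(\<Sum>k\<in>V - {s}. w k * weight k) + deg V E i * weight i =
      (\<Sum>k\<in>V - {s}. u k * weight k) + (\<Sum>k\<in>V - {s}. edge_mult E i k * weight k)"
    using fin i by (simp add: sum.distrib)
  moreover have "(\<Sum>k\<in>V - {s}. edge_mult E i k * weight k) \<le> (\<Sum>k\<in>V. edge_mult E i k * weight k)"
    using finite_V by (intro sum_mono2) auto
  ultimately show ?thesis
    using weight_superharmonic[OF i(1)] by linarith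
qed

lemma stable_reachable: "\<exists>w. (topple_step V E s)\<^sup>*\<^sup>* u w \<and> stable V E s w"
proof (induction "\<Sum>k\<in>V - {s}. u k * weight k" arbitrary: u rule: less_induct)
  case less
  show ?case
  proof (cases "stable V E s u")
    case False
    then obtain v where v: "topple_step V E s u v"
      using stable_iff_no_step by metis
    then show ?thesis
      using less[OF topple_step_weight_less[OF v]] converse_rtranclp_into_rtranclp by metis
  qed auto
qed

lemma
  shows steps_stabilization: "(topple_step V E s)\<^sup>*\<^sup>* u (stabilization V E s u)"
    and stable_stabilization: "stable V E s (stabilization V E s u)"
  using stable_reachable[of u] stabilization_eqI by metis+

lemma stabilization_configurations:
  "u \<in> configurations V s \<Longrightarrow> stabilization V E s u \<in> configurations V s"
  using steps_stabilization topple_steps_configurations by metis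

lemma stabilization_stable: "stable V E s u \<Longrightarrow> stabilization V E s u = u"
  by (rule stabilization_eqI) auto

text \<open>Extra grains keep every toppling of \<open>u\<close> legal, so \<open>u + v\<close>
  passes through the partially stabilized sum and ends at the same stable configuration.\<close>

lemma stabilization_add:
  assumes "v \<in> configurations V s"
  shows "stabilization V E s (\<lambda>i. stabilization V E s u i + v i) = stabilization V E s (\<lambda>i. u i + v i)"
proof (rule sym, rule stabilization_eqI)
  show "(topple_step V E s)\<^sup>*\<^sup>* (\<lambda>i. u i + v i)
      (stabilization V E s (\<lambda>i. stabilization V E s u i + v i))"
    using topple_steps_add[OF steps_stabilization assms] steps_stabilization by (meson rtranclp_trans)
qed (rule stable_stabilization)

lemma stabilization_subtree_sum_mod:
  assumes "j \<in> V - {s}"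
  shows "int (sum (stabilization V E s u) (subtree j)) mod int (edge_mult E j (par j)) =
    int (sum u (subtree j)) mod int (edge_mult E j (par j))"
  using topple_steps_subtree_sum_mod steps_stabilization assms by blast

section \<open>Recurrent configurations\<close>

lemma recurrent_stable: "recurrent V E s u \<Longrightarrow> stable V E s u"
  unfolding recurrent_def sandpile_add_def using stable_stabilization by metis

text \<open>The subtree of \<open>j\<close> is never forbidden, so some vertex in it holds as many
  grains as it has edges into the subtree. For a vertex other than \<open>j\<close> that number is
  its full degree, contrary to stability.\<close>

lemma recurrent_lower_bound:
  assumes "recurrent V E s u" and j: "j \<in> V - {s}"
  shows "deg V E j \<le> u j + edge_mult E j (par j)"
proof -
  \<comment> \<open>Recurrence is tested against a configuration in which every vertex is unstable,
    as \<open>topple_steps_no_forbidden\<close> requires at the start.\<close>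
  define v where "v i = (if i \<in> V - {s} then deg V E i else 0)" for i
  have "v \<in> configurations V s" by (simp add: v_def configurations_def)
  then obtain w where "sandpile_add V E s v w = u"
    using assms(1) by (auto simp: recurrent_def)
  then have steps: "(topple_step V E s)\<^sup>*\<^sup>* (\<lambda>i. v i + w i) u"
    unfolding sandpile_add_def using steps_stabilization by metis
  have "\<exists>i\<in>subtree j. (\<Sum>k\<in>subtree j. edge_mult E i k) \<le> u i"
    using subtree_refl subtree_subset j
    by (intro topple_steps_no_forbidden[OF steps finite_V]) (auto simp: v_def)
  then obtain i where i: "i \<in> subtree j" "(\<Sum>k\<in>subtree j. edge_mult E i k) \<le> u i"
    by blast
  have "i = j"
  proof (rule ccontr)
    assume "i \<noteq> j"
    then have "deg V E i \<le> u i" using i sum_edges_subtree_inner[OF j] by simp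
    moreover have "i \<in> V - {s}" using subtree_subset i j by blast
    ultimately show False
      using recurrent_stable[OF assms(1)] by (auto simp: stable_def not_less[symmetric])
  qed
  then show ?thesis using i sum_edges_subtree_root[OF j] by simp
qed

text \<open>If \<open>w\<close> leads from \<open>v\<close> to \<open>u\<close>, then
  \<open>w + x\<close> leads from \<open>v\<close> to the sum of \<open>u\<close> and
  \<open>x\<close>: recurrent configurations absorb addition.\<close>

lemma recurrent_sandpile_add:
  assumes u: "recurrent V E s u" and x: "x \<in> configurations V s"
  shows "recurrent V E s (sandpile_add V E s u x)"
  unfolding recurrent_def
proof (intro conjI ballI)
  have conf: "u \<in> configurations V s" using u by (simp add: recurrent_def)
  then show "sandpile_add V E s u x \<in> configurations V s"
    unfolding sandpile_add_def by (intro configurations_add stabilization_configurations x)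
  fix v assume v: "v \<in> configurations V s"
  then obtain w where w: "w \<in> configurations V s" "sandpile_add V E s v w = u"
    using u by (auto simp: recurrent_def)
  have "sandpile_add V E s u x = stabilization V E s (\<lambda>i. (v i + w i) + x i)"
    using w stabilization_add[OF x, of "\<lambda>i. v i + w i"] by (auto simp: sandpile_add_def)
  then have "sandpile_add V E s v (\<lambda>i. w i + x i) = sandpile_add V E s u x"
    by (simp add: sandpile_add_def add.assoc)
  then show "\<exists>w\<in>configurations V s. sandpile_add V E s v w = sandpile_add V E s u x"
    using configurations_add[OF w(1) x] by metis
qed

definition max_stable :: "'a \<Rightarrow> nat" where
  "max_stable i = (if i \<in> V - {s} then deg V E i - 1 else 0)"

lemma max_stable_configurations: "max_stable \<in> configurations V s"
  by (simp add: max_stable_def configurations_def)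

lemma deg_pos:
  assumes "j \<in> V - {s}" shows "0 < deg V E j"
  using sum_edges_subtree_root[OF assms] edge_mult_parent_pos[OF assms] by simp

text \<open>Any configuration can be stabilized first and then filled up to
  \<open>max_stable\<close>, which dominates every stable configuration.\<close>

lemma recurrent_max_stable: "recurrent V E s max_stable"
  unfolding recurrent_def
proof (intro conjI ballI)
  show "max_stable \<in> configurations V s" by (fact max_stable_configurations)
  fix v assume v: "v \<in> configurations V s"
  define v' where "v' = stabilization V E s v"
  have v': "stable V E s v'" "v' \<in> configurations V s"
    using v stable_stabilization stabilization_configurations by (auto simp: v'_def)
  define w where "w i = max_stable i - v' i" for i
  have w: "w \<in> configurations V s"
    using max_stable_configurations by (simp add: w_def configurations_def)
  have "v' i + w i = max_stable i" for i
  proof (cases "i \<in> V - {s}")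
    case True
    then have "v' i < deg V E i" using v'(1) by (simp add: stable_def)
    then show ?thesis using True by (simp add: w_def max_stable_def)
  next
    case False
    then show ?thesis using v'(2) by (simp add: w_def max_stable_def configurations_def)
  qed
  then have "sandpile_add V E s v w = stabilization V E s max_stable"
    using stabilization_add[OF w, of v] by (simp add: sandpile_add_def v'_def)
  also have "\<dots> = max_stable"
    using deg_pos by (intro stabilization_stable) (auto simp: stable_def max_stable_def)
  finally show "\<exists>w\<in>configurations V s. sandpile_add V E s v w = max_stable"
    using w by blast
qed

text \<open>The path of a vertex ends with the path of every vertex on it, so subtrees nest, and
  mutual containment would make the paths equal. This supports induction from the far ends of the
  tree towards the sink.\<close>

lemma subtree_less:
  assumes "j \<in> V" "i \<in> subtree j" "i \<noteq> j"
  shows "subtree i \<subset> subtree j"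
proof -
  have i: "i \<in> V" "j \<in> set (path_to_sink i)" using assms mem_subtree_iff by auto
  have suffix: "\<exists>xs. path_to_sink k = xs @ path_to_sink l" if "k \<in> subtree l" for k l
  proof -
    have k: "k \<in> V" "l \<in> set (path_to_sink k)" using that mem_subtree_iff by auto
    then obtain xs ys where split: "path_to_sink k = xs @ l # ys"
      by (auto dest: split_list)
    then have "path_to_sink l = l # ys"
      using is_path_path_to_sink[OF k(1)] is_path_suffix path_to_sink_eqI by metis
    then show ?thesis using split by simp
  qed
  have "subtree i \<subseteq> subtree j"
  proof
    fix k assume k: "k \<in> subtree i"
    then show "k \<in> subtree j" using suffix[OF k] i by (auto simp: mem_subtree_iff)
  qed
  moreover have "j \<notin> subtree i"
  proof
    assume "j \<in> subtree i"
    from suffix[OF this] suffix[OF assms(2)] have eq: "path_to_sink i = path_to_sink j" by force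
    have "j \<in> V" using \<open>j \<in> subtree i\<close> mem_subtree_iff by auto
    then show False
      using is_path_path_to_sink eq i assms(3) unfolding is_path_def by metis
  qed
  moreover have "j \<in> subtree j" using assms(1) by (rule subtree_refl)
  ultimately show ?thesis by blast
qed

text \<open>Once the values strictly above \<open>j\<close> agree, the residues make
  \<open>u j\<close> and \<open>w j\<close> congruent modulo \<open>edge_mult E j (par j)\<close>,
  and both lie in an interval containing just that many integers.\<close>

lemma recurrent_eqI:
  assumes u: "recurrent V E s u" and w: "recurrent V E s w"
    and mod: "\<And>j. j \<in> V - {s} \<Longrightarrow>
      int (sum u (subtree j)) mod int (edge_mult E j (par j)) =
      int (sum w (subtree j)) mod int (edge_mult E j (par j))"
  shows "u = w"
proof
  fix j
  show "u j = w j"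
  proof (cases "j \<in> V - {s}")
    case False
    then show ?thesis using u w by (simp add: recurrent_def configurations_def)
  next
    case True
    then show ?thesis
    proof (induction "card (subtree j)" arbitrary: j rule: less_induct)
      case (less j)
      define e where "e = int (edge_mult E j (par j))"
      have "u i = w i" if "i \<in> subtree j - {j}" for i
        using less.hyps[of i] that subtree_less[of j i] subtree_subset[of j] less.prems
          psubset_card_mono[OF finite_subtree, of "subtree i" j] by blast
      then have "sum u (subtree j - {j}) = sum w (subtree j - {j})"
        by (rule sum.cong[OF refl])
      then have "int (sum u (subtree j)) - int (sum w (subtree j)) = int (u j) - int (w j)"
        using subtree_refl[of j] less.prems finite_subtree by (simp add: sum.remove[of _ j])
      then have "e dvd int (u j) - int (w j)"
        using mod[OF less.prems] unfolding e_def by (metis mod_eq_dvd_iff)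
      moreover have "\<bar>int (u j) - int (w j)\<bar> < e"
      proof -
        have "u j < deg V E j" "w j < deg V E j"
          using recurrent_stable[OF u] recurrent_stable[OF w] less.prems by (auto simp: stable_def)
        then show ?thesis
          using recurrent_lower_bound[OF u less.prems] recurrent_lower_bound[OF w less.prems]
          by (simp add: e_def)
      qed
      ultimately show ?case
        by (metis dvd_imp_le_int not_less abs_of_nat e_def eq_iff_diff_eq_0 of_nat_eq_iff)
    qed
  qed
qed

section \<open>The identity configuration\<close>

lemma identity_exists:
  "\<exists>e. recurrent V E s e \<and> (\<forall>u. recurrent V E s u \<longrightarrow>
     sandpile_add V E s e u = u \<and> sandpile_add V E s u e = u)"
proof -
  \<comment> \<open>A common multiple of all the moduli, so that \<open>N\<close> copies of any
    configuration have all residues zero.\<close>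
  define N where "N = (\<Prod>j\<in>V - {s}. edge_mult E j (par j))"
  have "0 < N" unfolding N_def using edge_mult_parent_pos by (intro prod_pos) auto
  \<comment> \<open>Splitting off one copy of \<open>max_stable\<close> makes \<open>e\<close>
    recurrent by absorption. With zero residues, adding \<open>e\<close> leaves all residues
    unchanged, so \<open>recurrent_eqI\<close> shows that it acts as the identity.\<close>
  define e where "e = sandpile_add V E s max_stable (\<lambda>i. (N - 1) * max_stable i)"
  have rec: "recurrent V E s e"
    unfolding e_def using max_stable_configurations
    by (intro recurrent_sandpile_add recurrent_max_stable) (auto simp: configurations_def)
  have e: "e = stabilization V E s (\<lambda>i. N * max_stable i)"
    unfolding e_def sandpile_add_def using \<open>0 < N\<close> by (cases N) auto
  have e_mod: "int (sum e (subtree j)) mod int (edge_mult E j (par j)) = 0" if j: "j \<in> V - {s}" for j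
  proof -
    have "edge_mult E j (par j) dvd N"
      unfolding N_def using j finite_V by (intro dvd_prodI) auto
    then have "int (edge_mult E j (par j)) dvd int (sum (\<lambda>i. N * max_stable i) (subtree j))"
      by (simp flip: sum_distrib_left)
    then show ?thesis
      using stabilization_subtree_sum_mod[OF j] e by simp
  qed
  have "sandpile_add V E s e u = u" if u: "recurrent V E s u" for u
  proof (rule recurrent_eqI)
    show "recurrent V E s (sandpile_add V E s e u)"
      using recurrent_sandpile_add rec u by (simp add: recurrent_def)
    show "recurrent V E s u" by (fact u)
    fix j assume j: "j \<in> V - {s}"
    show "int (sum (sandpile_add V E s e u) (subtree j)) mod int (edge_mult E j (par j)) =
        int (sum u (subtree j)) mod int (edge_mult E j (par j))"
      unfolding sandpile_add_def stabilization_subtree_sum_mod[OF j]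
      using e_mod[OF j] by (simp add: sum.distrib) (metis add_0 mod_add_left_eq)
  qed
  then show ?thesis using rec sandpile_add_commute by metis
qed

text \<open>Two recurrent identities are equal, each being their sum; hence the description in
  \<open>sandpile_group\<close> denotes the one just constructed.\<close>

lemma
  defines "e \<equiv> \<one>\<^bsub>sandpile_group V E s\<^esub>"
  shows recurrent_identity: "recurrent V E s e"
    and identity_add: "recurrent V E s u \<Longrightarrow> sandpile_add V E s e u = u"
proof -
  have "\<exists>!e. recurrent V E s e \<and> (\<forall>u. recurrent V E s u \<longrightarrow>
     sandpile_add V E s e u = u \<and> sandpile_add V E s u e = u)"
    using identity_exists by metis
  from theI'[OF this] show "recurrent V E s e"
    "recurrent V E s u \<Longrightarrow> sandpile_add V E s e u = u"
    by (auto simp: e_def sandpile_group_def)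
qed

text \<open>The identity is idempotent, so each subtree sum is congruent to its own double.\<close>

lemma identity_subtree_sum_dvd:
  assumes "j \<in> V - {s}"
  shows "int (edge_mult E j (par j)) dvd int (sum \<one>\<^bsub>sandpile_group V E s\<^esub> (subtree j))"
proof -
  define e where "e = \<one>\<^bsub>sandpile_group V E s\<^esub>"
  have "stabilization V E s (\<lambda>i. e i + e i) = e"
    using identity_add[OF recurrent_identity] by (simp add: e_def sandpile_add_def)
  from stabilization_subtree_sum_mod[OF assms, of "\<lambda>i. e i + e i", unfolded this]
  have "int (sum e (subtree j)) mod int (edge_mult E j (par j)) =
      (int (sum e (subtree j)) + int (sum e (subtree j))) mod int (edge_mult E j (par j))"
    by (simp add: sum.distrib)
  then have "int (edge_mult E j (par j)) dvd
      int (sum e (subtree j)) + int (sum e (subtree j)) - int (sum e (subtree j))"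
    by (metis mod_eq_dvd_iff)
  then show ?thesis by (simp add: e_def)
qed

lemma identity_formula:
  assumes j: "j \<in> V - {s}"
  defines "e \<equiv> \<one>\<^bsub>sandpile_group V E s\<^esub>"
  shows "int (e j) = lam V E s e j * int (edge_mult E j (par j)) - int (above_sum V E s e j)"
proof -
  define A where "A = above_sum V E s e j"
  define c where "c = edge_mult E j (par j)"
  have c: "0 < c" using edge_mult_parent_pos[OF j] by (simp add: c_def)
  have "{i \<in> V. above E s i j} = subtree j - {j}"
    by (auto simp: above_def subtree_def)
  then have sum: "sum e (subtree j) = e j + A"
    using subtree_refl[of j] j finite_subtree by (simp add: A_def above_sum_def sum.remove[of _ j])
  obtain m where m: "int (e j + A) = int c * m"
    using identity_subtree_sum_dvd[OF j] unfolding e_def[symmetric] sum c_def by (auto simp: dvd_def)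
  have bounds: "deg V E j \<le> e j + c" "e j < deg V E j"
    using recurrent_lower_bound[OF _ j] recurrent_stable recurrent_identity j
    by (auto simp: e_def c_def stable_def)
  have "lam V E s e j = \<lfloor>real_of_int (int (deg V E j) + int A - 1) / real_of_int (int c)\<rfloor>"
    by (simp add: lam_def A_def c_def)
  also have "\<dots> = (int (deg V E j) + int A - 1) div int c"
    by (rule floor_divide_of_int_eq)
  also have "\<dots> = m"
  proof (rule int_div_pos_eq)
    \<comment> \<open>The bounds on \<open>e j\<close> place the remainder
      \<open>deg V E j - 1 - e j\<close> between 0 and \<open>c - 1\<close>, so the quotient is the
      multiplier \<open>m\<close>.\<close>
    show "int (deg V E j) + int A - 1 = int c * m + (int (deg V E j) - 1 - int (e j))"
      using m by simp
  qed (use bounds in auto)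
  finally show ?thesis using m by (simp add: A_def c_def mult.commute)
qed

text \<open>By induction on depth, the parent of any further vertex \<open>k\<close> of the subtree
  is \<open>j\<close> itself. Then \<open>k\<close> and \<open>par j\<close> are two distinct
  neighbours of \<open>j\<close>, too many for a leaf.\<close>

lemma leaf_subtree:
  assumes "leaf V E s j"
  shows "subtree j = {j}"
proof -
  have j: "j \<in> V - {s}" using assms by (simp add: leaf_def)
  have "k = j" if "k \<in> subtree j" for k
    using that
  proof (induction "depth k" arbitrary: k rule: less_induct)
    case (less k)
    show ?case
    proof (rule ccontr)
      assume "k \<noteq> j"
      have k: "k \<in> V - {s}" using less.prems subtree_subset j by blast
      note p = parent_edge_path[OF k]
      have pV: "par k \<in> V" using edge_in_V p by auto
      have "par k \<in> subtree j"
        using p less.prems \<open>k \<noteq> j\<close> pV by (auto simp: mem_subtree_iff)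
      moreover have "depth (par k) < depth k"
        using length_path_to_sink[of k] length_path_to_sink[OF pV] p k by simp
      ultimately have pk: "par k = j" using less.hyps by blast
      have "k \<noteq> par j"
        using less.prems parent_notin_subtree[OF j] by blast
      moreover have "{j, k} \<in># G" "{j, par j} \<in># G"
        using p pk parent_edge_path[OF j] by (auto simp: insert_commute)
      moreover have "(\<Sum>l\<in>{k, par j}. edge_mult G j l) \<le> deg V G j"
        unfolding deg_def using k edge_in_V[OF parent_edge_path(1)[OF j]] finite_V
        by (intro sum_mono2) auto
      ultimately have "2 \<le> deg V G j"
        unfolding edge_mult_def by (fastforce simp: Suc_le_eq simp flip: count_greater_zero_iff)
      then show False using assms by (simp add: leaf_def)
    qed
  qed
  then show ?thesis using subtree_refl j by blast
qed

lemma identity_leaf: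
  assumes "leaf V E s j" "edge_mult E j j = 0"
  shows "\<one>\<^bsub>sandpile_group V E s\<^esub> j = 0"
proof -
  define e where "e = \<one>\<^bsub>sandpile_group V E s\<^esub>"
  have j: "j \<in> V - {s}" using assms by (simp add: leaf_def)
  \<comment> \<open>The edges from \<open>j\<close> into its subtree are loops only, and there are
    none.\<close>
  have "deg V E j = edge_mult E j (par j)"
    using sum_edges_subtree_root[OF j] leaf_subtree assms by simp
  then have "e j < edge_mult E j (par j)"
    using recurrent_stable[OF recurrent_identity] j by (metis e_def stable_def)
  moreover have "edge_mult E j (par j) dvd e j"
    using identity_subtree_sum_dvd[OF j] leaf_subtree[OF assms(1)] by (simp add: e_def)
  ultimately show ?thesis
    using nat_dvd_not_less[of "e j"] by (auto simp: e_def)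
qed

end

theorem corollary3p6:
  fixes V :: "'a set" and E :: "'a set multiset" and s :: 'a and eT :: "'a \<Rightarrow> nat"
  assumes "thick_tree V E"
    and "s \<in> V"
    and "eT = \<one>\<^bsub>sandpile_group V E s\<^esub>"
  shows "\<forall>j\<in>V - {s}.
    int (eT j) =
      (if leaf V E s j \<and> edge_mult E j j = 0 then 0
       else lam V E s eT j * int (edge_mult E j (parent E s j)) - int (above_sum V E s eT j))"
proof -
  interpret rooted_thick_tree V E s
    using assms by unfold_locales
  show ?thesis
  proof
    fix j assume "j \<in> V - {s}"
    then show "int (eT j) =
      (if leaf V E s j \<and> edge_mult E j j = 0 then 0
       else lam V E s eT j * int (edge_mult E j (parent E s j)) - int (above_sum V E s eT j))"
    proof (cases "leaf V E s j \<and> edge_mult E j j = 0")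
      case True
      then have "eT j = 0" unfolding assms(3) by (intro identity_leaf) auto
      then show ?thesis using True by simp
    next
      case False
      then show ?thesis
        unfolding assms(3) if_not_P[OF False] using \<open>j \<in> V - {s}\<close> by (intro identity_formula)
    qed
  qed
qed

end
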